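(* Let $n,m\ge 1$ be integers and $p\in[0,1]$. Let $G^*(n,m,p)$ be the random bipartite graph with disjoint vertex sets $V$ ($|V|=n$) and $W$ ($|W|=m$), in which each pair $\{v,w\}$ with $v\in V$, $w\in W$ is an edge independently with probability $p$, and there are no edges inside $V$ or inside $W$. Let $G^{active}(n,m,p)$ be the graph on vertex set $V$ in which distinct $v_1,v_2\in V$ are adjacent if and only if there is some $w\in W$ adjacent in $G^*(n,m,p)$ to both $v_1$ and $v_2$; and let $G^{passive}(n,m,p)$ be the graph on vertex set $W$ in which distinct $w_1,w_2\in W$ are adjacent if and only if there is some $v\in V$ adjacent in $G^*(n,m,p)$ to both $w_1$ and $w_2$. Fix $v\in V$ and $w\in W$, let $X$ be the number of vertices of $V\setminus\{v\}$ adjacent to $v$ in $G^{active}(n,m,p)$, and let $Y$ be the number of vertices of $W\setminus\{w\}$ adjacent to $w$ in $G^{passive}(n,m,p)$. Then for all $x,y\in\mathbb{R}$, the joint probability generating function $F(x,y):=\mathbb{E}\,x^Xy^Y$ is given by \begin{eqnarray*} F(x,y)&=&\sum_{k=0}^{n-1}\sum_{l=0}^{m-1}{n-1 \choose k}{m-1\choose l}x^{n-1-k}(1-x)^ky^{m-1-l}(1-y)^l\\ & &\cdot \big[1-p+p(1-p)^k\big]^{m-1-l}\big[1-p+p(1-p)^l\big]^{n-1-k}\\ & &\cdot \Big[(1-p)^{k+l}p+(1-p)\sum_{i=0}^l{l\choose i}p^{i}(1-p)^{l-i}\big[(1-p)^{i+1}+p(1-p)^l\big]^k\Big]. \end{e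qnarray*}
   Context: Convention: $0^0=1$. *)

theory Defs
  imports "HOL-Probability.Probability" "HOL-Probability.Product_PMF"
begin

text \<open>A graph on a given vertex set is represented by its edge set, an edge being the
  unordered pair of its endpoints.\<close>

definition bipartite_pairs :: "'a set \<Rightarrow> 'a set \<Rightarrow> 'a set set" where
  "bipartite_pairs V W = {{v, w} | v w. v \<in> V \<and> w \<in> W}"

text \<open>The law of \<open>G\<^sup>*(n,m,p)\<close>: a family of independent Bernoulli variables
  indexed by the pairs, viewed as the set of pairs at which the value is \<open>True\<close>.\<close>

definition random_bipartite_graph :: "'a set \<Rightarrow> 'a set \<Rightarrow> real \<Rightarrow> 'a set set pmf" where
  "random_bipartite_graph V W p =
     map_pmf (\<lambda>b. {e \<in> bipartite_pairs V W. b e})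
       (Pi_pmf (bipartite_pairs V W) False (\<lambda>_. bernoulli_pmf p))"

definition intersection_graph :: "'a set \<Rightarrow> 'a set \<Rightarrow> 'a set set \<Rightarrow> 'a set set" where
  "intersection_graph A B E =
     {{a1, a2} | a1 a2. a1 \<in> A \<and> a2 \<in> A \<and> a1 \<noteq> a2 \<and>
        (\<exists>b\<in>B. {a1, b} \<in> E \<and> {a2, b} \<in> E)}"

definition active_graph :: "'a set \<Rightarrow> 'a set \<Rightarrow> 'a set set \<Rightarrow> 'a set set" where
  "active_graph V W E = intersection_graph V W E"

definition passive_graph :: "'a set \<Rightarrow> 'a set \<Rightarrow> 'a set set \<Rightarrow> 'a set set" where
  "passive_graph V W E = intersection_graph W V E"

definition num_neighbours :: "'a set \<Rightarrow> 'a set set \<Rightarrow> 'a \<Rightarrow> nat" where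
  "num_neighbours A E a = card {u \<in> A - {a}. {a, u} \<in> E}"

end

theory Submission
  imports Defs
begin

text \<open>Expanding \<open>x ^ X * y ^ Y\<close> over sets \<open>K \<subseteq> V - {v}\<close> and \<open>L \<subseteq> W - {w}\<close> reduces the claim to the
  probability that \<open>v\<close> has no neighbour in \<open>K\<close> and \<open>w\<close> none in \<open>L\<close>. The rows of the adjacency matrix are
  independent random subsets of \<open>W\<close>, and given the row \<open>S\<close> of \<open>v\<close> this event is a product of
  conditions on single rows: each row \<open>R\<close> containing \<open>w\<close> (that of \<open>v\<close> included) avoids \<open>L\<close>, and the
  rows of \<open>K\<close> avoid \<open>S\<close>. Averaging over \<open>S\<close>, according to whether \<open>w \<in> S\<close>, gives the two terms of the
  last factor; \<open>i\<close> is the size of \<open>S \<inter> L\<close>.\<close>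

section \<open>Means over random subsets of a finite set\<close>

text \<open>For finite \<open>A\<close>, the mean of \<open>f\<close> over a random subset
  containing each element independently with probability \<open>p\<close>. Being a finite sum, it
  makes sense for every real \<open>p\<close>, in particular for the weights \<open>1 - x\<close>
  and \<open>1 - y\<close>.\<close>

definition subset_mean :: "real \<Rightarrow> 'a set \<Rightarrow> ('a set \<Rightarrow> real) \<Rightarrow> real" where
  "subset_mean p A f = (\<Sum>S\<in>Pow A. p ^ card S * (1 - p) ^ card (A - S) * f S)"

lemma subset_mean_empty [simp]: "subset_mean p {} f = f {}"
  by (simp add: subset_mean_def)

lemma subset_mean_cong:
  "A = B \<Longrightarrow> (\<And>S. S \<subseteq> B \<Longrightarrow> f S = g S) \<Longrightarrow> subset_mean p A f = subset_mean p B g"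
  by (auto simp: subset_mean_def intro!: sum.cong)

lemma subset_mean_mult_left: "subset_mean p A (\<lambda>S. c * f S) = c * subset_mean p A f"
  by (simp add: subset_mean_def sum_distrib_left mult.left_commute)

lemma subset_mean_mult_right: "subset_mean p A (\<lambda>S. f S * c) = subset_mean p A f * c"
  by (simp add: subset_mean_def sum_distrib_right mult.assoc)

lemma subset_mean_zero [simp]: "subset_mean p A (\<lambda>S. 0) = 0"
  by (simp add: subset_mean_def)

lemma subset_mean_swap:
  "subset_mean p A (\<lambda>S. subset_mean q B (f S)) = subset_mean q B (\<lambda>T. subset_mean p A (\<lambda>S. f S T))"
  unfolding subset_mean_def sum_distrib_left by (subst sum.swap) (simp add: mult_ac)

text \<open>Conditioning on whether \<open>a\<close> is chosen. This recursion drives the inductions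
  for unions, images and products.\<close>

lemma subset_mean_insert:
  assumes "finite A" "a \<notin> A"
  shows "subset_mean p (insert a A) f =
    p * subset_mean p A (\<lambda>S. f (insert a S)) + (1 - p) * subset_mean p A f"
proof -
  have *: "card (insert a S) = Suc (card S)" "insert a A - insert a S = A - S"
    "card (insert a A - S) = Suc (card (A - S))" if "S \<subseteq> A" for S
  proof -
    show "card (insert a S) = Suc (card S)"
      using that assms by (metis card_insert_disjoint in_mono rev_finite_subset)
    show "insert a A - insert a S = A - S" using that assms by auto
    have "insert a A - S = insert a (A - S)" using that assms by auto
    then show "card (insert a A - S) = Suc (card (A - S))" using assms by simp
  qed
  have inj: "inj_on (insert a) (Pow A)"
    using assms by (auto simp: inj_on_def)
  have "subset_mean p (insert a A) f =
      (\<Sum>S\<in>Pow A. p ^ card S * (1 - p) ^ card (insert a A - S) * f S) +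
      (\<Sum>S\<in>insert a ` Pow A. p ^ card S * (1 - p) ^ card (insert a A - S) * f S)"
    unfolding subset_mean_def Pow_insert using assms by (intro sum.union_disjoint) auto
  also have "(\<Sum>S\<in>Pow A. p ^ card S * (1 - p) ^ card (insert a A - S) * f S) =
      (1 - p) * subset_mean p A f"
    unfolding subset_mean_def sum_distrib_left by (rule sum.cong) (auto simp: *)
  also have "(\<Sum>S\<in>insert a ` Pow A. p ^ card S * (1 - p) ^ card (insert a A - S) * f S) =
      p * subset_mean p A (\<lambda>S. f (insert a S))"
    unfolding subset_mean_def sum_distrib_left sum.reindex[OF inj] o_def
    by (rule sum.cong) (simp_all only: Pow_iff * power_Suc mult.assoc)
  finally show ?thesis by simp
qed

lemma subset_mean_Un:
  assumes "finite A" "finite B" "A \<inter> B = {}"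
  shows "subset_mean p (A \<union> B) f = subset_mean p A (\<lambda>S. subset_mean p B (\<lambda>T. f (S \<union> T)))"
  using assms(1,3)
proof (induction A arbitrary: f rule: finite_induct)
  case (insert a A)
  then show ?case using assms(2) by (simp add: subset_mean_insert)
qed simp

lemma subset_mean_image:
  assumes "finite A" "inj_on h A"
  shows "subset_mean p (h ` A) f = subset_mean p A (\<lambda>S. f (h ` S))"
  using assms
proof (induction A arbitrary: f rule: finite_induct)
  case (insert a A)
  then show ?case by (simp add: subset_mean_insert)
qed simp

text \<open>By independence each element contributes its own factor. Powers of the size and
  indicators of disjointness are evaluated by writing them as such products.\<close>

lemma subset_mean_prod:
  assumes "finite A"
  shows "subset_mean p A (\<lambda>S. \<Prod>a\<in>A. if a \<in> S then f a else g a) =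
    (\<Prod>a\<in>A. p * f a + (1 - p) * g a)"
  using assms
proof (induction A rule: finite_induct)
  case (insert a A)
  have *: "subset_mean p A (\<lambda>S. \<Prod>b\<in>insert a A. if b \<in> insert a S then f b else g b) =
      f a * subset_mean p A (\<lambda>S. \<Prod>b\<in>A. if b \<in> S then f b else g b)"
    unfolding subset_mean_mult_left[symmetric] using insert.hyps
    by (intro subset_mean_cong refl) (auto intro!: prod.cong)
  have **: "subset_mean p A (\<lambda>S. \<Prod>b\<in>insert a A. if b \<in> S then f b else g b) =
      g a * subset_mean p A (\<lambda>S. \<Prod>b\<in>A. if b \<in> S then f b else g b)"
    unfolding subset_mean_mult_left[symmetric] using insert.hyps
    by (intro subset_mean_cong refl) auto
  show ?case
    unfolding subset_mean_insert[OF insert.hyps] * ** using insert by (simp add: algebra_simps)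
qed simp

text \<open>The binomial generating function; at \<open>z = (1-p) ^ k\<close> it yields the factor
  \<open>1 - p + p * (1-p) ^ k\<close>.\<close>

lemma subset_mean_power_card:
  assumes "finite A"
  shows "subset_mean p A (\<lambda>S. z ^ card S) = (1 - p + p * z) ^ card A"
proof -
  have "z ^ card S = (\<Prod>a\<in>A. if a \<in> S then z else 1)" if "S \<subseteq> A" for S
    using that assms by (simp add: prod.If_cases Int_absorb1)
  then have "subset_mean p A (\<lambda>S. z ^ card S) =
      subset_mean p A (\<lambda>S. \<Prod>a\<in>A. if a \<in> S then z else 1)"
    by (intro subset_mean_cong) auto
  then show ?thesis using assms by (simp add: subset_mean_prod add.commute)
qed

lemma subset_mean_disjoint:
  assumes "finite A" "T \<subseteq> A"
  shows "subset_mean p A (\<lambda>S. of_bool (S \<inter> T = {})) = (1 - p) ^ card T"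
proof -
  \<comment> \<open>A factor vanishes exactly at the elements of
    \<open>S \<inter> T\<close>.\<close>
  have "of_bool (S \<inter> T = {}) = (\<Prod>a\<in>A. if a \<in> S then of_bool (a \<notin> T) else 1 :: real)"
    if "S \<subseteq> A" for S
  proof (cases "S \<inter> T = {}")
    case True
    then have "(\<Prod>a\<in>A. if a \<in> S then of_bool (a \<notin> T) else 1 :: real) = 1"
      by (intro prod.neutral) auto
    with True show ?thesis by simp
  qed (use that assms in auto)
  then have "subset_mean p A (\<lambda>S. of_bool (S \<inter> T = {})) =
      (\<Prod>a\<in>A. p * of_bool (a \<notin> T) + (1 - p) * 1)"
    unfolding subset_mean_prod[OF assms(1), symmetric] by (intro subset_mean_cong) auto
  also have "\<dots> = (\<Prod>a\<in>A. if a \<in> T then 1 - p else 1)"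
    by (rule prod.cong) auto
  finally show ?thesis using assms by (simp add: prod.If_cases Int_absorb1)
qed

text \<open>Subsets are grouped by size. The sums over \<open>k\<close>, \<open>l\<close> and
  \<open>i\<close> in the claim all arise this way.\<close>

lemma subset_mean_card:
  assumes "finite A"
  shows "subset_mean p A (\<lambda>S. f (card S)) =
    (\<Sum>k=0..card A. real (card A choose k) * p ^ k * (1 - p) ^ (card A - k) * f k)"
proof -
  have "subset_mean p A (\<lambda>S. f (card S)) =
      (\<Sum>S\<in>Pow A. p ^ card S * (1 - p) ^ (card A - card S) * f (card S))"
    unfolding subset_mean_def using assms
    by (intro sum.cong) (auto simp: card_Diff_subset finite_subset)
  also have "\<dots> = (\<Sum>k=0..card A. \<Sum>S\<in>{S\<in>Pow A. card S = k}.
      p ^ card S * (1 - p) ^ (card A - card S) * f (card S))"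
    using assms by (intro sum.group[symmetric]) (auto intro: card_mono)
  also have "\<dots> = (\<Sum>k=0..card A. \<Sum>S\<in>{S\<in>Pow A. card S = k}. p ^ k * (1 - p) ^ (card A - k) * f k)"
    by (intro sum.cong) auto
  finally show ?thesis using assms by (simp add: n_subsets mult_ac)
qed

text \<open>The product over \<open>A\<close> of \<open>x + (1 - x) \<cdot> of_bool (\<not> P u)\<close> expanded; the weight \<open>1 - x\<close> need not be
  a probability.\<close>

lemma power_card_filter_eq_subset_mean:
  assumes "finite A"
  shows "x ^ card {u\<in>A. P u} = subset_mean (1 - x) A (\<lambda>K. of_bool (\<forall>u\<in>K. \<not> P u))"
proof -
  have "subset_mean (1 - x) A (\<lambda>K. of_bool (\<forall>u\<in>K. \<not> P u)) =
      subset_mean (1 - x) A (\<lambda>K. of_bool (K \<inter> {u\<in>A. P u} = {}))"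
    by (intro subset_mean_cong) auto
  also have "\<dots> = x ^ card {u\<in>A. P u}"
    by (subst subset_mean_disjoint) (use assms in auto)
  finally show ?thesis by simp
qed

section \<open>From the random graph to a finite sum\<close>

lemma expectation_random_subset:
  assumes "finite A" "0 \<le> p" "p \<le> 1"
  shows "measure_pmf.expectation (map_pmf (\<lambda>b. {e\<in>A. b e}) (Pi_pmf A False (\<lambda>_. bernoulli_pmf p))) f =
    subset_mean p A f"
proof -
  let ?M = "Pi_pmf A False (\<lambda>_. bernoulli_pmf p)"
  let ?B = "PiE_dflt A False (\<lambda>_. UNIV :: bool set)"
  have "finite ?B" using assms by (intro finite_PiE_dflt) auto
  then have "measure_pmf.expectation (map_pmf (\<lambda>b. {e\<in>A. b e}) ?M) f = (\<Sum>b\<in>?B. f {e\<in>A. b e} * pmf ?M b)"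
    unfolding integral_map_pmf
    by (rule integral_measure_pmf_real)
       (use assms in \<open>auto simp: set_Pi_pmf PiE_dflt_def\<close>)
  also have "\<dots> = (\<Sum>S\<in>Pow A. f S * (\<Prod>e\<in>A. if e \<in> S then p else 1 - p))"
  \<comment> \<open>The default \<open>False\<close> outside \<open>A\<close> makes \<open>b\<close>
    recoverable from \<open>{e\<in>A. b e}\<close>, so \<open>?B\<close> corresponds bijectively to
    \<open>Pow A\<close>.\<close>
  proof (rule sum.reindex_bij_witness[of _ "\<lambda>S e. e \<in> S" "\<lambda>b. {e\<in>A. b e}"])
    fix b assume b: "b \<in> ?B"
    then have "pmf ?M b = (\<Prod>e\<in>A. pmf (bernoulli_pmf p) (b e))"
      by (intro pmf_Pi' assms) (auto simp: PiE_dflt_def)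
    also have "\<dots> = (\<Prod>e\<in>A. if e \<in> {e\<in>A. b e} then p else 1 - p)"
      using assms by (intro prod.cong) auto
    finally show "f {e\<in>A. b e} * (\<Prod>e\<in>A. if e \<in> {e\<in>A. b e} then p else 1 - p) =
        f {e\<in>A. b e} * pmf ?M b" by simp
  qed (auto simp: PiE_dflt_def)
  also have "\<dots> = subset_mean p A f"
    unfolding subset_mean_def using assms(1)
    by (intro sum.cong) (auto simp: prod.If_cases Int_absorb1 Diff_eq)
  finally show ?thesis .
qed

section \<open>Rows of the adjacency matrix and their independence\<close>

definition row :: "'a set \<Rightarrow> 'a set set \<Rightarrow> 'a \<Rightarrow> 'a set" where
  "row W E a = {b\<in>W. {a, b} \<in> E}"

lemma bipartite_pairs_insert:
  "bipartite_pairs (insert a V) W = (\<lambda>b. {a, b}) ` W \<union> bipartite_pairs V W"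
  by (auto simp: bipartite_pairs_def)

lemma finite_bipartite_pairs:
  assumes "finite V" "finite W"
  shows "finite (bipartite_pairs V W)"
proof -
  have "bipartite_pairs V W = (\<lambda>(a, b). {a, b}) ` (V \<times> W)"
    by (auto simp: bipartite_pairs_def)
  then show ?thesis using assms by simp
qed

text \<open>The pairs at the new vertex \<open>a\<close> form a copy of \<open>W\<close> disjoint
  from the other pairs, so the row of \<open>a\<close> can be averaged separately.\<close>

lemma subset_mean_bipartite_pairs_insert:
  assumes "finite V" "finite W" "insert a V \<inter> W = {}" "a \<notin> V"
  shows "subset_mean p (bipartite_pairs (insert a V) W) f =
    subset_mean p W (\<lambda>S. subset_mean p (bipartite_pairs V W) (\<lambda>E. f ((\<lambda>b. {a, b}) ` S \<union> E)))"
proof -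
  have "(\<lambda>b. {a, b}) ` W \<inter> bipartite_pairs V W = {}"
    using assms by (auto simp: bipartite_pairs_def doubleton_eq_iff)
  moreover have "inj_on (\<lambda>b. {a, b}) W"
    by (auto simp: inj_on_def doubleton_eq_iff)
  ultimately show ?thesis
    using assms
    by (simp add: bipartite_pairs_insert subset_mean_Un subset_mean_image finite_bipartite_pairs)
qed

text \<open>Pairs are unordered, but \<open>a\<close> lies neither in \<open>V\<close> nor in
  \<open>W\<close>, so no pair in \<open>E\<close> contains \<open>a\<close>.\<close>

lemma row_Un_image:
  assumes "insert a V \<inter> W = {}" "a \<notin> V" "S \<subseteq> W" "E \<subseteq> bipartite_pairs V W"
  shows "row W ((\<lambda>b. {a, b}) ` S \<union> E) c = (if c = a then S else row W E c)"
proof -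
  have "{a, b} \<notin> E" if "b \<in> W" for b
  proof
    assume "{a, b} \<in> E"
    then obtain v w where "{a, b} = {v, w}" "v \<in> V" "w \<in> W"
      using assms(4) unfolding bipartite_pairs_def by blast
    then show False using assms that by (auto simp: doubleton_eq_iff)
  qed
  then show ?thesis using assms by (auto simp: row_def doubleton_eq_iff)
qed

text \<open>Independence of the rows, obtained by splitting off one row at a time.\<close>

lemma subset_mean_prod_rows:
  assumes "finite V" "finite W" "V \<inter> W = {}"
  shows "subset_mean p (bipartite_pairs V W) (\<lambda>E. \<Prod>a\<in>V. g a (row W E a)) =
    (\<Prod>a\<in>V. subset_mean p W (g a))"
  using assms(1,3)
proof (induction V rule: finite_induct)
  case empty
  have "bipartite_pairs {} W = {}" by (simp add: bipartite_pairs_def)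
  then show ?case by simp
next
  case (insert a V)
  have "subset_mean p (bipartite_pairs (insert a V) W) (\<lambda>E. \<Prod>c\<in>insert a V. g c (row W E c)) =
      subset_mean p W (\<lambda>S. subset_mean p (bipartite_pairs V W)
        (\<lambda>E. \<Prod>c\<in>insert a V. g c (row W ((\<lambda>b. {a, b}) ` S \<union> E) c)))"
    using insert assms(2) by (subst subset_mean_bipartite_pairs_insert) auto
  also have "\<dots> = subset_mean p W (\<lambda>S. subset_mean p (bipartite_pairs V W)
      (\<lambda>E. g a S * (\<Prod>c\<in>V. g c (row W E c))))"
    using insert.hyps
    by (intro subset_mean_cong refl)
       (auto simp: row_Un_image[OF insert.prems insert.hyps(2)] intro!: prod.cong arg_cong2[where f = "(*)"])
  also have "\<dots> = subset_mean p W (g a) * (\<Prod>c\<in>V. subset_mean p W (g c))"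
    using insert by (simp add: subset_mean_mult_left subset_mean_mult_right)
  finally show ?case using insert.hyps by simp
qed

text \<open>Here \<open>S\<close> stands for the row of \<open>v\<close> and \<open>R\<close> for the row of another vertex of \<open>V\<close>.\<close>

lemma subset_mean_row_compatible:
  assumes "finite W" "w \<in> W" "L \<subseteq> W - {w}" "S \<subseteq> W - {w}"
  shows "subset_mean p W (\<lambda>R. of_bool (R \<inter> S = {} \<and> (w \<in> R \<longrightarrow> R \<inter> L = {}))) =
      (1 - p) * (1 - p) ^ card S + p * (1 - p) ^ card (S \<union> L)"
    and "subset_mean p W (\<lambda>R. of_bool (R \<inter> insert w S = {} \<and> (w \<in> R \<longrightarrow> R \<inter> L = {}))) =
      (1 - p) ^ Suc (card S)"
proof -
  define U where "U = W - {w}"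
  have U: "W = insert w U" "w \<notin> U" "finite U" "L \<subseteq> U" "S \<subseteq> U"
    using assms by (auto simp: U_def)
  \<comment> \<open>Split by whether \<open>w \<in> R\<close>. If not, the condition on
    \<open>L\<close> is vacuous; if so, \<open>R\<close> must avoid both \<open>S\<close> and
    \<open>L\<close>, which is impossible once \<open>w\<close> belongs to the row of
    \<open>v\<close>.\<close>
  have 1: "subset_mean p U (\<lambda>R. of_bool (R \<inter> S = {} \<and> (w \<in> R \<longrightarrow> R \<inter> L = {}))) =
      subset_mean p U (\<lambda>R. of_bool (R \<inter> S = {}))"
    "subset_mean p U (\<lambda>R. of_bool (R \<inter> insert w S = {} \<and> (w \<in> R \<longrightarrow> R \<inter> L = {}))) =
      subset_mean p U (\<lambda>R. of_bool (R \<inter> S = {}))"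
    "subset_mean p U (\<lambda>R. of_bool (insert w R \<inter> S = {} \<and> (w \<in> insert w R \<longrightarrow> insert w R \<inter> L = {}))) =
      subset_mean p U (\<lambda>R. of_bool (R \<inter> (S \<union> L) = {}))"
    using U by (intro subset_mean_cong refl arg_cong[where f = of_bool]; blast)+
  show "subset_mean p W (\<lambda>R. of_bool (R \<inter> S = {} \<and> (w \<in> R \<longrightarrow> R \<inter> L = {}))) =
      (1 - p) * (1 - p) ^ card S + p * (1 - p) ^ card (S \<union> L)"
    unfolding U(1) subset_mean_insert[OF U(3,2)] 1 using U by (simp add: subset_mean_disjoint)
  show "subset_mean p W (\<lambda>R. of_bool (R \<inter> insert w S = {} \<and> (w \<in> R \<longrightarrow> R \<inter> L = {}))) =
      (1 - p) ^ Suc (card S)"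
    unfolding U(1) subset_mean_insert[OF U(3,2)] 1 using U by (simp add: subset_mean_disjoint)
qed

section \<open>The probability of no neighbours in \<open>K\<close> and \<open>L\<close>\<close>

text \<open>The row of \<open>v\<close> is split into its parts in \<open>{w}\<close>,
  \<open>L\<close> and \<open>M\<close>. Whether or not it contains \<open>w\<close>, averaging over
  the part in \<open>M\<close> gives the same power of \<open>1 - p + p * (1-p) ^ card K\<close>,
  which therefore factors out.\<close>

lemma subset_mean_no_neighbours:
  assumes "finite V" "finite W" "V \<inter> W = {}" "v \<in> V" "w \<in> W" "K \<subseteq> V - {v}" "L \<subseteq> W - {w}"
  shows "subset_mean p (bipartite_pairs V W)
      (\<lambda>E. of_bool ((\<forall>u\<in>K. row W E v \<inter> row W E u = {}) \<and>
        (\<forall>b\<in>L. \<not> (\<exists>a\<in>V. w \<in> row W E a \<and> b \<in> row W E a)))) =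
    (1 - p + p * (1-p) ^ card K) ^ card (W - {w} - L) * (1 - p + p * (1-p) ^ card L) ^ card (V - {v} - K) *
    ((1-p) ^ (card K + card L) * p +
      (1-p) * (\<Sum>i=0..card L. real (card L choose i) * p ^ i * (1-p) ^ (card L - i) *
        ((1-p) ^ (i+1) + p * (1-p) ^ card L) ^ card K))" (is "?lhs = _")
proof -
  define U where "U = V - {v}"
  define M where "M = W - {w} - L"
  \<comment> \<open>\<open>g S a\<close> is the condition on the row of \<open>a\<close>, with
    disjointness from \<open>S\<close> imposed only for \<open>a \<in> K\<close>; \<open>C S\<close>
    is the condition on the row of \<open>v\<close> itself. A row in \<open>K\<close> is admissible
    with probability \<open>q S\<close>, any other with probability \<open>r\<close>.\<close>
  define g :: "'a set \<Rightarrow> 'a \<Rightarrow> 'a set \<Rightarrow> real" where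
    "g S a R = of_bool (R \<inter> (if a \<in> K then S else {}) = {} \<and> (w \<in> R \<longrightarrow> R \<inter> L = {}))" for S a R
  define C :: "'a set \<Rightarrow> real" where "C S = of_bool (w \<in> S \<longrightarrow> S \<inter> L = {})" for S
  define r where "r = 1 - p + p * (1-p) ^ card L"
  define q where "q S = subset_mean p W (\<lambda>R. of_bool (R \<inter> S = {} \<and> (w \<in> R \<longrightarrow> R \<inter> L = {})))" for S
  define k where "k = card K"
  define l where "l = card L"
  have V: "V = insert v U" "v \<notin> U" "finite U" "K \<subseteq> U" "insert v U \<inter> W = {}" "U \<inter> W = {}"
    using assms by (auto simp: U_def)
  have W: "W = insert w (L \<union> M)" "w \<notin> L \<union> M" "finite L" "finite M" "L \<inter> M = {}"
    using assms finite_subset[OF assms(7)] by (auto simp: M_def)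
  have "?lhs = subset_mean p W (\<lambda>S. subset_mean p (bipartite_pairs U W)
      (\<lambda>E. C S * (\<Prod>a\<in>U. g S a (row W E a))))"
    unfolding V(1) subset_mean_bipartite_pairs_insert[OF V(3) assms(2) V(5) V(2)]
  proof (intro subset_mean_cong refl)
    fix S E assume S: "S \<subseteq> W" and E: "E \<subseteq> bipartite_pairs U W"
    let ?E = "(\<lambda>b. {v, b}) ` S \<union> E"
    have "C S * (\<Prod>a\<in>U. g S a (row W E a)) =
        of_bool ((w \<in> S \<longrightarrow> S \<inter> L = {}) \<and> (\<forall>a\<in>U. row W E a \<inter> (if a \<in> K then S else {}) = {} \<and>
          (w \<in> row W E a \<longrightarrow> row W E a \<inter> L = {})))"
      unfolding C_def g_def using V(3) by (auto simp: of_bool_def intro!: prod.neutral)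
    \<comment> \<open>Exchanging quantifiers: no \<open>b \<in> L\<close> shares a row with
      \<open>w\<close> iff every row containing \<open>w\<close> avoids \<open>L\<close>. The row of
      \<open>v\<close> accounts for the clause on \<open>S\<close>.\<close>
    also have "\<dots> = of_bool ((\<forall>u\<in>K. row W ?E v \<inter> row W ?E u = {}) \<and>
        (\<forall>b\<in>L. \<not> (\<exists>a\<in>insert v U. w \<in> row W ?E a \<and> b \<in> row W ?E a)))"
      unfolding row_Un_image[OF V(5,2) S E] using V(2,4)
      by (intro arg_cong[where f = of_bool]) (auto split: if_splits)
    finally show "of_bool ((\<forall>u\<in>K. row W ?E v \<inter> row W ?E u = {}) \<and>
        (\<forall>b\<in>L. \<not> (\<exists>a\<in>insert v U. w \<in> row W ?E a \<and> b \<in> row W ?E a))) =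
      C S * (\<Prod>a\<in>U. g S a (row W E a))" by simp
  qed
  also have "\<dots> = subset_mean p W (\<lambda>S. C S * (\<Prod>a\<in>U. subset_mean p W (g S a)))"
    unfolding subset_mean_mult_left subset_mean_prod_rows[OF V(3) assms(2) V(6)] ..
  also have "\<dots> = subset_mean p W (\<lambda>S. C S * (q S ^ k * r ^ card (U - K)))"
  proof (intro subset_mean_cong refl arg_cong2[where f = "(*)"])
    fix S
    have "subset_mean p W (g S a) = (if a \<in> K then q S else r)" for a
      using subset_mean_row_compatible(1)[OF assms(2,5,7), of "{}" p]
      by (cases "a \<in> K") (simp_all add: g_def[abs_def] q_def r_def)
    then show "(\<Prod>a\<in>U. subset_mean p W (g S a)) = q S ^ k * r ^ card (U - K)"
      using V by (simp add: prod.If_cases Int_absorb1 k_def Diff_eq)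
  qed
  also have "\<dots> = subset_mean p W (\<lambda>S. C S * q S ^ k) * r ^ card (U - K)"
    by (simp add: subset_mean_mult_right flip: mult.assoc)
  also have "subset_mean p W (\<lambda>S. C S * q S ^ k) =
      p * subset_mean p L (\<lambda>S. subset_mean p M (\<lambda>T. C (insert w (S \<union> T)) * q (insert w (S \<union> T)) ^ k)) +
      (1 - p) * subset_mean p L (\<lambda>S. subset_mean p M (\<lambda>T. C (S \<union> T) * q (S \<union> T) ^ k))"
    by (subst W(1), subst subset_mean_insert) (use W in \<open>auto simp: subset_mean_Un\<close>)
  \<comment> \<open>If \<open>v\<close> is joined to \<open>w\<close>, its row must avoid
    \<open>L\<close>, leaving only \<open>S = {}\<close>. The rows of \<open>K\<close> then avoid
    \<open>w\<close>, so \<open>L\<close> does not constrain them and each has probability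
    \<open>(1-p) ^ (1 + card T)\<close>.\<close>
  also have "subset_mean p L (\<lambda>S. subset_mean p M (\<lambda>T. C (insert w (S \<union> T)) * q (insert w (S \<union> T)) ^ k)) =
      subset_mean p L (\<lambda>S. subset_mean p M (\<lambda>T. of_bool (S \<inter> L = {}) * ((1-p) ^ k * ((1-p) ^ k) ^ card T)))"
  proof (intro subset_mean_cong refl)
    fix S T assume ST: "S \<subseteq> L" "T \<subseteq> M"
    have C: "C (insert w (S \<union> T)) = of_bool (S \<inter> L = {})"
      unfolding C_def using ST W by (intro arg_cong[where f = of_bool]) blast
    show "C (insert w (S \<union> T)) * q (insert w (S \<union> T)) ^ k =
        of_bool (S \<inter> L = {}) * ((1-p) ^ k * ((1-p) ^ k) ^ card T)"
    proof (cases "S = {}")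
      case True
      have "T \<subseteq> W - {w}" using ST W by auto
      from subset_mean_row_compatible(2)[OF assms(2,5,7) this, of p] show ?thesis
        unfolding C q_def using True
        by (simp add: power_mult_distrib mult.commute flip: power_mult)
    next
      case False
      then show ?thesis unfolding C using ST by (simp add: Int_absorb2)
    qed
  qed
  also have "\<dots> = (1-p) ^ l * ((1-p) ^ k * (1 - p + p * (1-p) ^ k) ^ card M)"
    using W by (simp add: subset_mean_mult_left subset_mean_mult_right subset_mean_power_card
        subset_mean_disjoint l_def)
  \<comment> \<open>If \<open>v\<close> is not joined to \<open>w\<close>, its row is unconstrained.
    Since \<open>S \<subseteq> L\<close>, the union \<open>S \<union> T \<union> L\<close> has
    \<open>l + card T\<close> elements, so \<open>(1-p) ^ card T\<close> splits off from both terms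
    of \<open>q (S \<union> T)\<close>.\<close>
  also have "subset_mean p L (\<lambda>S. subset_mean p M (\<lambda>T. C (S \<union> T) * q (S \<union> T) ^ k)) =
      subset_mean p L (\<lambda>S. subset_mean p M (\<lambda>T.
        ((1-p) ^ (card S + 1) + p * (1-p) ^ l) ^ k * ((1-p) ^ k) ^ card T))"
  proof (intro subset_mean_cong refl)
    fix S T assume ST: "S \<subseteq> L" "T \<subseteq> M"
    have C: "C (S \<union> T) = 1" using ST W by (auto simp: C_def)
    have fin: "finite S" "finite T" using ST W by (auto intro: finite_subset)
    have *: "card (S \<union> T) = card S + card T"
      using fin ST W by (intro card_Un_disjoint) auto
    have "S \<union> T \<union> L = L \<union> T" using ST by auto
    then have **: "card (S \<union> T \<union> L) = l + card T"
      unfolding l_def using fin ST W by (simp, intro card_Un_disjoint) auto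
    have "S \<union> T \<subseteq> W - {w}" using ST W by auto
    from subset_mean_row_compatible(1)[OF assms(2,5,7) this, of p]
    have "q (S \<union> T) = ((1-p) ^ (card S + 1) + p * (1-p) ^ l) * (1-p) ^ card T"
      unfolding q_def * ** by (simp add: power_add algebra_simps)
    then show "C (S \<union> T) * q (S \<union> T) ^ k =
        ((1-p) ^ (card S + 1) + p * (1-p) ^ l) ^ k * ((1-p) ^ k) ^ card T"
      by (simp add: C power_mult_distrib mult.commute flip: power_mult)
  qed
  also have "\<dots> = subset_mean p L (\<lambda>S. ((1-p) ^ (card S + 1) + p * (1-p) ^ l) ^ k) *
      (1 - p + p * (1-p) ^ k) ^ card M"
    using W by (simp add: subset_mean_mult_left subset_mean_mult_right subset_mean_power_card)
  also have "subset_mean p L (\<lambda>S. ((1-p) ^ (card S + 1) + p * (1-p) ^ l) ^ k) =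
      (\<Sum>i=0..l. real (l choose i) * p ^ i * (1-p) ^ (l - i) * ((1-p) ^ (i+1) + p * (1-p) ^ l) ^ k)"
    using subset_mean_card[OF W(3), of p "\<lambda>i. ((1-p) ^ (i+1) + p * (1-p) ^ l) ^ k"]
    by (simp add: l_def)
  finally show ?thesis
    unfolding k_def[symmetric] l_def[symmetric] U_def[symmetric] M_def[symmetric] r_def
    by (simp add: power_add algebra_simps)
qed

section \<open>Neighbour counts and the generating function\<close>

lemma num_neighbours_active_graph:
  assumes "v \<in> V"
  shows "num_neighbours V (active_graph V W E) v =
    card {u\<in>V - {v}. row W E v \<inter> row W E u \<noteq> {}}"
proof -
  have "{v, u} \<in> active_graph V W E \<longleftrightarrow> row W E v \<inter> row W E u \<noteq> {}" if "u \<in> V - {v}" for u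
    using that assms unfolding active_graph_def intersection_graph_def row_def
    by (auto simp: doubleton_eq_iff)
  then show ?thesis unfolding num_neighbours_def by (metis (mono_tags, lifting))
qed

text \<open>A common neighbour \<open>a\<close> of \<open>w\<close> and \<open>b\<close> is a row
  containing both, so this count too is expressed through rows rather than columns.\<close>

lemma num_neighbours_passive_graph:
  assumes "w \<in> W"
  shows "num_neighbours W (passive_graph V W E) w =
    card {b\<in>W - {w}. \<exists>a\<in>V. w \<in> row W E a \<and> b \<in> row W E a}"
proof -
  have "{w, b} \<in> passive_graph V W E \<longleftrightarrow> (\<exists>a\<in>V. w \<in> row W E a \<and> b \<in> row W E a)"
    if "b \<in> W - {w}" for b
    using that assms unfolding passive_graph_def intersection_graph_def row_def
    by (fastforce simp: doubleton_eq_iff insert_commute)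
  then show ?thesis unfolding num_neighbours_def by (metis (mono_tags, lifting))
qed

theorem theorem1:
  fixes V W :: "'a set" and n m :: nat and p :: real and v w :: 'a and x y :: real
  assumes "n \<ge> 1" and "m \<ge> 1" and "0 \<le> p" and "p \<le> 1"
    and "finite V" and "card V = n"
    and "finite W" and "card W = m"
    and "V \<inter> W = {}"
    and "v \<in> V" and "w \<in> W"
  shows "measure_pmf.expectation (random_bipartite_graph V W p)
           (\<lambda>E. x ^ num_neighbours V (active_graph V W E) v *
                y ^ num_neighbours W (passive_graph V W E) w) =
         (\<Sum>k=0..n-1. \<Sum>l=0..m-1.
            real ((n-1) choose k) * real ((m-1) choose l) *
            x ^ (n-1-k) * (1-x) ^ k * y ^ (m-1-l) * (1-y) ^ l *
            (1 - p + p * (1-p) ^ k) ^ (m-1-l) * (1 - p + p * (1-p) ^ l) ^ (n-1-k) *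
            ((1-p) ^ (k+l) * p +
             (1-p) * (\<Sum>i=0..l. real (l choose i) * p ^ i * (1-p) ^ (l-i) *
                        ((1-p) ^ (i+1) + p * (1-p) ^ l) ^ k)))"
proof -
  \<comment> \<open>The avoidance probability depends on \<open>K\<close> and \<open>L\<close> only
    through their sizes \<open>k\<close> and \<open>l\<close>.\<close>
  define h where "h k l = (1 - p + p * (1-p) ^ k) ^ (m-1-l) * (1 - p + p * (1-p) ^ l) ^ (n-1-k) *
      ((1-p) ^ (k+l) * p + (1-p) * (\<Sum>i=0..l. real (l choose i) * p ^ i * (1-p) ^ (l-i) *
        ((1-p) ^ (i+1) + p * (1-p) ^ l) ^ k))" for k l
  let ?P = "\<lambda>E u. row W E v \<inter> row W E u \<noteq> {}"
  let ?Q = "\<lambda>E b. \<exists>a\<in>V. w \<in> row W E a \<and> b \<in> row W E a"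
  have fin: "finite (V - {v})" "finite (W - {w})" "finite (bipartite_pairs V W)"
    using assms by (auto intro: finite_bipartite_pairs)
  have card: "card (V - {v}) = n - 1" "card (W - {w}) = m - 1"
    using assms by auto
  have "measure_pmf.expectation (random_bipartite_graph V W p)
      (\<lambda>E. x ^ num_neighbours V (active_graph V W E) v * y ^ num_neighbours W (passive_graph V W E) w) =
    subset_mean p (bipartite_pairs V W) (\<lambda>E. subset_mean (1 - x) (V - {v}) (\<lambda>K.
      subset_mean (1 - y) (W - {w}) (\<lambda>L. of_bool ((\<forall>u\<in>K. \<not> ?P E u) \<and> (\<forall>b\<in>L. \<not> ?Q E b)))))"
    unfolding random_bipartite_graph_def expectation_random_subset[OF fin(3) assms(3,4)]
      num_neighbours_active_graph[OF assms(10)] num_neighbours_passive_graph[OF assms(11)]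
      power_card_filter_eq_subset_mean[OF fin(1)] power_card_filter_eq_subset_mean[OF fin(2)]
      of_bool_conj subset_mean_mult_left subset_mean_mult_right ..
  also have "\<dots> = subset_mean (1 - x) (V - {v}) (\<lambda>K. subset_mean (1 - y) (W - {w}) (\<lambda>L.
      subset_mean p (bipartite_pairs V W) (\<lambda>E. of_bool ((\<forall>u\<in>K. \<not> ?P E u) \<and> (\<forall>b\<in>L. \<not> ?Q E b)))))"
    \<comment> \<open>The mean over \<open>E\<close> moves inwards past \<open>K\<close>, then past
      \<open>L\<close>; fixing \<open>p\<close> in the second exchange keeps it from undoing the
      first.\<close>
    by (subst subset_mean_swap, subst subset_mean_swap[of p], rule refl)
  also have "\<dots> = subset_mean (1 - x) (V - {v}) (\<lambda>K. subset_mean (1 - y) (W - {w}) (\<lambda>L. h (card K) (card L)))"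
  proof (intro subset_mean_cong refl)
    fix K L assume KL: "K \<subseteq> V - {v}" "L \<subseteq> W - {w}"
    have "card (V - {v} - K) = n - 1 - card K" "card (W - {w} - L) = m - 1 - card L"
      using KL fin card by (auto simp: card_Diff_subset finite_subset)
    with subset_mean_no_neighbours[OF assms(5,7,9,10,11) KL, of p]
    show "subset_mean p (bipartite_pairs V W)
        (\<lambda>E. of_bool ((\<forall>u\<in>K. \<not> ?P E u) \<and> (\<forall>b\<in>L. \<not> ?Q E b))) = h (card K) (card L)"
      by (simp add: h_def)
  qed
  \<comment> \<open>Grouping by \<open>card L\<close> inside and by \<open>card K\<close> outside;
    the complementary weights \<open>1 - (1 - x)\<close> and \<open>1 - (1 - y)\<close> become
    \<open>x\<close> and \<open>y\<close>.\<close>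
  also have "\<dots> = (\<Sum>k=0..n-1. real ((n-1) choose k) * (1-x) ^ k * x ^ (n-1-k) *
      (\<Sum>l=0..m-1. real ((m-1) choose l) * (1-y) ^ l * y ^ (m-1-l) * h k l))"
    unfolding subset_mean_card[OF fin(2)] card
    using subset_mean_card[OF fin(1), of "1 - x" "\<lambda>k. \<Sum>l=0..m-1. real ((m-1) choose l) *
      (1-y) ^ l * (1 - (1 - y)) ^ (m-1-l) * h k l"] card by simp
  finally show ?thesis
    unfolding h_def by (simp only: sum_distrib_left mult_ac)
qed

end
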